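(* Consider the linear network $x\mapsto W^2W^1x$ with $W^1\in\mathbb{R}^{N_h\times N_x}$, $W^2\in\mathbb{R}^{N_y\times N_h}$, $N_h<N_x,N_y$, trained on samples $(x_\mu,y_\mu)$, $\mu=1,\dots,P$, with orthogonal inputs, by gradient flow on the squared error, from the initialization $$W^2_0=U^{yy}M^2O^T,\qquad W^1_0=O\,M^1(V^{xx})^T,$$ where $U^{yy}$ and $V^{xx}$ are the matrices of left and right singular vectors of the input-output correlation matrix $\Sigma^{yx}=\sum_{\mu=1}^P y_\mu x_\mu^T$. Let $D_t=W^2_tW^1_t-W^2_0W^1_0$ be the cumulative update of the product matrix at iteration (time) $t$. Then for any orthogonal matrix $O$ and scaled diagonal matrices $M^2$ and $M^1$, each singular value $u_f(t)$ in $D_t$ at iteration $t$ follows the trajectory $$u_f(t)=\frac{s\,e^{2st/\tau}}{e^{2st/\tau}-1+s/u_0}-u_0,$$ where $s$ is the target singular value in $\Sigma^{yx}$, $u_0$ is the initial value determined by $M^2$ and $M^1$, and $\tau$ is a constant.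
   Context: The training samples are $(x_\mu,y_\mu)\in\mathbb{R}^{N_x}\times\mathbb{R}^{N_y}$. The inputs are orthogonal, i.e. $x_i^Tx_j=0$ for $i\neq j$, and $\Sigma^{xx}=\sum_{\mu}x_\mu x_\mu^T$ is taken to be the identity. The network (called a 3-layer linear network, i.e. one hidden layer of width $N_h$) is trained on the squared error $\frac12\sum_{\mu=1}^P\|y_\mu-W^2W^1x_\mu\|_2^2$. Training is modelled in continuous time by the gradient flow $$\tau\frac{d}{dt}W^1=(W^2)^T(\Sigma^{yx}-W^2W^1\Sigma^{xx}),\qquad \tau\frac{d}{dt}W^2=(\Sigma^{yx}-W^2W^1\Sigma^{xx})(W^1)^T,$$ where $\tau$ is a time constant, and $W^1_t,W^2_t$ denote the weights at time $t$. The singular value decomposition is $\Sigma^{yx}=U^{yy}S^{yx}(V^{xx})^T=\sum_{\alpha=1}^{N_x}s_\alpha u_\alpha v_\alpha^T$ with $s_1\ge s_2\ge\dots\ge s_{N_x}$; each index $\alpha$ is called a mode. The matrices $M^2$ ($N_y\times N_h$) and $M^1$ ($N_h\times N_x$) are diagonal and control the scale of the initial weights; $O$ is $N_h\times N_h$. With this initialization each mode evolves independently. In the formula, for a given mode $\alpha$, $s=s_\alpha$, $u_0$ is the initial strength of that mode in $W^2_0W^1_0$, and $u_f(t)$ is the strength of that mode in $D_t$.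
   Formalization: The trajectory is claimed for modes whose diagonal entries in M^2 and M^1 are equal (it fails for unequal ones unless u_0=s) and with u_0 and s nonzero, where the formula is defined; u_f(t) is the signed strength of the mode in D_t. *)

theory Defs
  imports Complex_Main "Jordan_Normal_Form.Matrix"
begin

(* The library's "orthogonal_mat" only asks that the columns be nonzero and pairwise
   orthogonal, not that they be normalised. *)
definition real_orthogonal_mat :: "nat \<Rightarrow> real mat \<Rightarrow> bool" where
  "real_orthogonal_mat n A \<longleftrightarrow> A \<in> carrier_mat n n \<and> A\<^sup>T * A = 1\<^sub>m n \<and> A * A\<^sup>T = 1\<^sub>m n"

(* A is the sum over k < min nr nc of F_kk (col U k) (col V k)^T; equivalently, F_kk is the
   strength of mode k in A.  No sign or order is imposed on the diagonal of F, so the F_kk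
   are singular values up to sign and order. *)
definition mode_decomposition ::
  "nat \<Rightarrow> nat \<Rightarrow> real mat \<Rightarrow> real mat \<Rightarrow> real mat \<Rightarrow> real mat \<Rightarrow> bool" where
  "mode_decomposition nr nc A U F V \<longleftrightarrow>
     real_orthogonal_mat nr U \<and> real_orthogonal_mat nc V \<and>
     F \<in> carrier_mat nr nc \<and> diagonal_mat F \<and> A = U * F * V\<^sup>T"

definition singular_value_decomposition ::
  "nat \<Rightarrow> nat \<Rightarrow> real mat \<Rightarrow> real mat \<Rightarrow> real mat \<Rightarrow> real mat \<Rightarrow> bool" where
  "singular_value_decomposition nr nc A U S V \<longleftrightarrow>
     mode_decomposition nr nc A U S V \<and>
     (\<forall>i < min nr nc. S $$ (i, i) \<ge> 0) \<and>
     (\<forall>i j. i \<le> j \<and> j < min nr nc \<longrightarrow> S $$ (j, j) \<le> S $$ (i, i))"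

(* The sum over m < P of a_m b_m^T, where a_m has dimension nr and b_m dimension nc. *)
definition correlation_mat ::
  "nat \<Rightarrow> nat \<Rightarrow> nat \<Rightarrow> (nat \<Rightarrow> real vec) \<Rightarrow> (nat \<Rightarrow> real vec) \<Rightarrow> real mat" where
  "correlation_mat nr nc P a b = mat nr nc (\<lambda>(i, j). \<Sum>m<P. a m $ i * b m $ j)"

definition squared_error ::
  "nat \<Rightarrow> (nat \<Rightarrow> real vec) \<Rightarrow> (nat \<Rightarrow> real vec) \<Rightarrow> real mat \<Rightarrow> real mat \<Rightarrow> real" where
  "squared_error P x y W1 W2 =
     1/2 * (\<Sum>m<P. (y m - (W2 * W1) *\<^sub>v x m) \<bullet> (y m - (W2 * W1) *\<^sub>v x m))"

definition has_mat_derivative ::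
  "(real \<Rightarrow> real mat) \<Rightarrow> real mat \<Rightarrow> real filter \<Rightarrow> bool" where
  "has_mat_derivative W G F \<longleftrightarrow>
     (\<forall>i < dim_row G. \<forall>j < dim_col G. ((\<lambda>t. W t $$ (i, j)) has_real_derivative G $$ (i, j)) F)"

(* Sxx and Syx are the input and input-output correlation matrices.  Up to the factor 1/\<tau>,
   the right-hand sides are minus the gradient of squared_error: see the lemma
   squared_error_derivative below. *)
definition gradient_flow ::
  "nat \<Rightarrow> nat \<Rightarrow> nat \<Rightarrow> real \<Rightarrow> real mat \<Rightarrow> real mat \<Rightarrow>
   (real \<Rightarrow> real mat) \<Rightarrow> (real \<Rightarrow> real mat) \<Rightarrow> bool" where
  "gradient_flow Nx Nh Ny \<tau> Sxx Syx W1 W2 \<longleftrightarrow>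
     (\<forall>t\<ge>0. W1 t \<in> carrier_mat Nh Nx \<and> W2 t \<in> carrier_mat Ny Nh \<and>
        has_mat_derivative W1
          ((1 / \<tau>) \<cdot>\<^sub>m ((W2 t)\<^sup>T * (Syx - W2 t * W1 t * Sxx))) (at t within {0..}) \<and>
        has_mat_derivative W2
          ((1 / \<tau>) \<cdot>\<^sub>m ((Syx - W2 t * W1 t * Sxx) * (W1 t)\<^sup>T)) (at t within {0..}))"

lemma squared_error_derivative:
  fixes x y :: "nat \<Rightarrow> real vec" and W1 W2 :: "real \<Rightarrow> real mat"
  assumes x: "\<And>m. m < P \<Longrightarrow> x m \<in> carrier_vec Nx"
    and y: "\<And>m. m < P \<Longrightarrow> y m \<in> carrier_vec Ny"
    and W1: "\<And>h. W1 h \<in> carrier_mat Nh Nx" and W2: "\<And>h. W2 h \<in> carrier_mat Ny Nh"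
    and G1: "G1 \<in> carrier_mat Nh Nx" and G2: "G2 \<in> carrier_mat Ny Nh"
    and d1: "has_mat_derivative W1 G1 (at t)" and d2: "has_mat_derivative W2 G2 (at t)"
  defines "R \<equiv> correlation_mat Ny Nx P y x - W2 t * W1 t * correlation_mat Nx Nx P x x"
  shows "((\<lambda>h. squared_error P x y (W1 h) (W2 h)) has_real_derivative
     - (\<Sum>k<Nh. \<Sum>j<Nx. ((W2 t)\<^sup>T * R) $$ (k, j) * G1 $$ (k, j))
     - (\<Sum>i<Ny. \<Sum>k<Nh. (R * (W1 t)\<^sup>T) $$ (i, k) * G2 $$ (i, k))) (at t)"
proof -
  define A B where "A h i k = W2 h $$ (i, k)" and "B h k j = W1 h $$ (k, j)" for h i k j
  define C where "C h i j = (\<Sum>k<Nh. A h i k * B h k j)" for h i j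
  define r where "r h m i = y m $ i - (\<Sum>j<Nx. C h i j * x m $ j)" for h m i
  have dA: "((\<lambda>h. A h i k) has_real_derivative G2 $$ (i, k)) (at t)" if "i < Ny" "k < Nh" for i k
    using d2 G2 that by (auto simp: has_mat_derivative_def A_def)
  have dB: "((\<lambda>h. B h k j) has_real_derivative G1 $$ (k, j)) (at t)" if "k < Nh" "j < Nx" for k j
    using d1 G1 that by (auto simp: has_mat_derivative_def B_def)
  have mm: "(X * Y) $$ (i, j) = (\<Sum>k<n. X $$ (i, k) * Y $$ (k, j))"
    if "X \<in> carrier_mat a n" "Y \<in> carrier_mat n b" "i < a" "j < b" for X Y :: "real mat" and a n b i j
    using that by (auto simp: scalar_prod_def atLeast0LessThan intro!: sum.cong)
  have mv: "(X *\<^sub>v v) $ i = (\<Sum>k<n. X $$ (i, k) * v $ k)"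
    if "X \<in> carrier_mat a n" "v \<in> carrier_vec n" "i < a" for X :: "real mat" and v a n i
    using that by (auto simp: scalar_prod_def atLeast0LessThan intro!: sum.cong)
  have WWc: "W2 h * W1 h \<in> carrier_mat Ny Nx" for h
    by (rule mult_carrier_mat[OF W2 W1])
  have WW: "(W2 h * W1 h) $$ (i, j) = C h i j" if "i < Ny" "j < Nx" for h i j
    using mm[OF W2 W1 that] by (simp add: C_def A_def B_def)
  have vec: "(y m - (W2 h * W1 h) *\<^sub>v x m) $ i = r h m i" if "m < P" "i < Ny" for h m i
  proof -
    have "((W2 h * W1 h) *\<^sub>v x m) $ i = (\<Sum>j<Nx. C h i j * x m $ j)"
      unfolding mv[OF WWc x[OF that(1)] that(2)] using WW that by (intro sum.cong) auto
    moreover have "dim_vec ((W2 h * W1 h) *\<^sub>v x m) = Ny"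
      using WWc[of h] by (simp del: index_mult_mat)
    ultimately show ?thesis
      using that unfolding r_def by (simp del: index_mult_mat_vec)
  qed
  have loss: "squared_error P x y (W1 h) (W2 h) = 1/2 * (\<Sum>m<P. \<Sum>i<Ny. (r h m i)\<^sup>2)" for h
  proof -
    have "(y m - (W2 h * W1 h) *\<^sub>v x m) \<bullet> (y m - (W2 h * W1 h) *\<^sub>v x m) = (\<Sum>i<Ny. (r h m i)\<^sup>2)"
      if m: "m < P" for m
    proof -
      have "dim_vec (y m - (W2 h * W1 h) *\<^sub>v x m) = Ny"
        using W2[of h] by auto
      then show ?thesis
        unfolding scalar_prod_def atLeast0LessThan power2_eq_square
        by (intro sum.cong) (simp_all only: vec[OF m] lessThan_iff)
    qed
    then show ?thesis unfolding squared_error_def by simp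
  qed
  define dC where "dC i j = (\<Sum>k<Nh. A t i k * G1 $$ (k, j) + G2 $$ (i, k) * B t k j)" for i j
  have dC: "((\<lambda>h. C h i j) has_real_derivative dC i j) (at t)" if "i < Ny" "j < Nx" for i j
    unfolding C_def dC_def
    by (rule DERIV_sum, rule derivative_eq_intros, rule dA, use that in simp, simp,
        rule dB, simp, use that in simp, simp)
  have dr: "((\<lambda>h. r h m i) has_real_derivative - (\<Sum>j<Nx. dC i j * x m $ j)) (at t)"
    if "i < Ny" for m i
  proof -
    have "((\<lambda>h. \<Sum>j<Nx. C h i j * x m $ j) has_real_derivative (\<Sum>j<Nx. dC i j * x m $ j)) (at t)"
      by (rule DERIV_sum, rule DERIV_cmult_right, rule dC, use that in simp, simp)
    from DERIV_diff[OF DERIV_const this] show ?thesis unfolding r_def by simp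
  qed
  have R: "R $$ (i, j) = (\<Sum>m<P. r t m i * x m $ j)" if ij: "i < Ny" "j < Nx" for i j
  proof -
    have "(W2 t * W1 t * correlation_mat Nx Nx P x x) $$ (i, j)
        = (\<Sum>l<Nx. C t i l * (\<Sum>m<P. x m $ l * x m $ j))"
    proof -
      have c: "correlation_mat Nx Nx P x x \<in> carrier_mat Nx Nx"
        by (simp add: correlation_mat_def)
      show ?thesis
        unfolding mm[OF WWc c ij] using WW ij by (intro sum.cong) (auto simp: correlation_mat_def)
    qed
    also have "\<dots> = (\<Sum>m<P. (\<Sum>l<Nx. C t i l * x m $ l) * x m $ j)"
      unfolding sum_distrib_left sum_distrib_right
      by (subst sum.swap) (simp add: mult.assoc)
    finally show ?thesis
      using ij W1[of t] W2[of t] unfolding R_def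
      by (simp del: index_mult_mat(1) add: correlation_mat_def r_def left_diff_distrib sum_subtractf)
  qed
  have Rc: "R \<in> carrier_mat Ny Nx"
    unfolding R_def correlation_mat_def using W1[of t] W2[of t] by auto
  have g1: "((W2 t)\<^sup>T * R) $$ (k, j) = (\<Sum>i<Ny. A t i k * R $$ (i, j))" if "k < Nh" "j < Nx" for k j
    using mm[of "(W2 t)\<^sup>T" Nh Ny R Nx k j] that Rc W2[of t] by (simp add: A_def del: index_mult_mat)
  have g2: "(R * (W1 t)\<^sup>T) $$ (i, k) = (\<Sum>j<Nx. R $$ (i, j) * B t k j)" if "i < Ny" "k < Nh" for i k
    using mm[of R Ny Nx "(W1 t)\<^sup>T" Nh i k] that Rc W1[of t] by (simp add: B_def del: index_mult_mat)
  have "((\<lambda>h. squared_error P x y (W1 h) (W2 h)) has_real_derivative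
     1/2 * (\<Sum>m<P. \<Sum>i<Ny. 2 * r t m i * - (\<Sum>j<Nx. dC i j * x m $ j))) (at t)"
    unfolding loss
  proof (intro DERIV_cmult DERIV_sum)
    fix m i assume "i \<in> {..<Ny}"
    then show "((\<lambda>h. (r h m i)\<^sup>2) has_real_derivative
        2 * r t m i * - (\<Sum>j<Nx. dC i j * x m $ j)) (at t)"
      using DERIV_power[OF dr[of i m], of 2] by (simp add: mult_ac)
  qed
  moreover have "1/2 * (\<Sum>m<P. \<Sum>i<Ny. 2 * r t m i * - (\<Sum>j<Nx. dC i j * x m $ j))
      = - (\<Sum>i<Ny. \<Sum>j<Nx. R $$ (i, j) * dC i j)"
  proof -
    have "1/2 * (\<Sum>m<P. \<Sum>i<Ny. 2 * r t m i * - (\<Sum>j<Nx. dC i j * x m $ j))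
        = - (\<Sum>m<P. \<Sum>i<Ny. \<Sum>j<Nx. r t m i * x m $ j * dC i j)"
      by (simp add: sum_distrib_left sum_negf mult_ac)
    also have "(\<Sum>m<P. \<Sum>i<Ny. \<Sum>j<Nx. r t m i * x m $ j * dC i j)
        = (\<Sum>i<Ny. \<Sum>m<P. \<Sum>j<Nx. r t m i * x m $ j * dC i j)"
      by (rule sum.swap)
    also have "\<dots> = (\<Sum>i<Ny. \<Sum>j<Nx. \<Sum>m<P. r t m i * x m $ j * dC i j)"
      by (intro sum.cong refl sum.swap)
    also have "\<dots> = (\<Sum>i<Ny. \<Sum>j<Nx. R $$ (i, j) * dC i j)"
      by (intro sum.cong refl) (simp add: R sum_distrib_right)
    finally show ?thesis .
  qed
  moreover have "(\<Sum>i<Ny. \<Sum>j<Nx. R $$ (i, j) * dC i j)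
      = (\<Sum>k<Nh. \<Sum>j<Nx. ((W2 t)\<^sup>T * R) $$ (k, j) * G1 $$ (k, j))
      + (\<Sum>i<Ny. \<Sum>k<Nh. (R * (W1 t)\<^sup>T) $$ (i, k) * G2 $$ (i, k))"
  proof -
    have "(\<Sum>i<Ny. \<Sum>j<Nx. R $$ (i, j) * dC i j)
      = (\<Sum>i<Ny. \<Sum>j<Nx. \<Sum>k<Nh. A t i k * R $$ (i, j) * G1 $$ (k, j))
      + (\<Sum>i<Ny. \<Sum>j<Nx. \<Sum>k<Nh. R $$ (i, j) * B t k j * G2 $$ (i, k))"
      by (simp add: dC_def sum_distrib_left distrib_left sum.distrib mult_ac)
    also have "(\<Sum>i<Ny. \<Sum>j<Nx. \<Sum>k<Nh. A t i k * R $$ (i, j) * G1 $$ (k, j))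
      = (\<Sum>k<Nh. \<Sum>j<Nx. ((W2 t)\<^sup>T * R) $$ (k, j) * G1 $$ (k, j))"
    proof -
      have "(\<Sum>i<Ny. \<Sum>j<Nx. \<Sum>k<Nh. A t i k * R $$ (i, j) * G1 $$ (k, j))
        = (\<Sum>i<Ny. \<Sum>k<Nh. \<Sum>j<Nx. A t i k * R $$ (i, j) * G1 $$ (k, j))"
        by (intro sum.cong refl sum.swap)
      also have "\<dots> = (\<Sum>k<Nh. \<Sum>i<Ny. \<Sum>j<Nx. A t i k * R $$ (i, j) * G1 $$ (k, j))"
        by (rule sum.swap)
      also have "\<dots> = (\<Sum>k<Nh. \<Sum>j<Nx. \<Sum>i<Ny. A t i k * R $$ (i, j) * G1 $$ (k, j))"
        by (intro sum.cong refl sum.swap)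
      also have "\<dots> = (\<Sum>k<Nh. \<Sum>j<Nx. ((W2 t)\<^sup>T * R) $$ (k, j) * G1 $$ (k, j))"
        by (intro sum.cong refl) (simp add: g1 sum_distrib_right del: index_mult_mat)
      finally show ?thesis .
    qed
    also have "(\<Sum>i<Ny. \<Sum>j<Nx. \<Sum>k<Nh. R $$ (i, j) * B t k j * G2 $$ (i, k))
      = (\<Sum>i<Ny. \<Sum>k<Nh. (R * (W1 t)\<^sup>T) $$ (i, k) * G2 $$ (i, k))"
    proof -
      have "(\<Sum>i<Ny. \<Sum>j<Nx. \<Sum>k<Nh. R $$ (i, j) * B t k j * G2 $$ (i, k))
        = (\<Sum>i<Ny. \<Sum>k<Nh. \<Sum>j<Nx. R $$ (i, j) * B t k j * G2 $$ (i, k))"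
        by (intro sum.cong refl sum.swap)
      also have "\<dots> = (\<Sum>i<Ny. \<Sum>k<Nh. (R * (W1 t)\<^sup>T) $$ (i, k) * G2 $$ (i, k))"
        by (intro sum.cong refl) (simp add: g2 sum_distrib_right del: index_mult_mat)
      finally show ?thesis .
    qed
    finally show ?thesis .
  qed
  ultimately show ?thesis
    by (simp only: minus_add_distrib diff_conv_add_uminus)
qed

end

theory Submission
  imports Defs
begin

text \<open>
  In the rotated coordinates \<open>A = U\<^sup>T W2 Q\<close>, \<open>B = Q\<^sup>T W1 V\<close> the flow reads
  \<open>\<tau> A' = (S - A B) B\<^sup>T\<close>, \<open>\<tau> B' = A\<^sup>T (S - A B)\<close> with diagonal initial data. The
  off-diagonal entries are controlled by a Gronwall estimate and so stay zero, which decouples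
  the modes. A mode with balanced start \<open>a = b\<close> stays balanced, and then \<open>u = a b\<close> solves the
  logistic equation \<open>\<tau> u' = 2 u (s - u)\<close>. To avoid dividing by \<open>u\<close>, the closed form is
  verified in the shape \<open>w = u d - s e = 0\<close>, where \<open>e = exp (2 s t / \<tau>)\<close> and
  \<open>d = e - 1 + s / u0\<close>: here \<open>\<tau> w' = 2 (s - u) w\<close> and \<open>w 0 = 0\<close>.
\<close>

section \<open>Gronwall estimates and scalar linear equations\<close>

text \<open>The energy \<open>E\<close>, the sum of the squares, satisfies E' \<le> K E on [0, T],
  so \<open>E\<close> times exp(-K t) does not increase there; it starts at 0, and \<open>E\<close>
  cannot be negative. The bound is asked only up to \<open>T\<close>, so \<open>C\<close> may depend
  on \<open>T\<close>; this suits coefficients that are merely continuous.\<close>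

lemma zero_of_growth_bound:
  fixes f g :: "'i \<Rightarrow> real \<Rightarrow> real"
  assumes fin: "finite I"
    and d: "\<And>i t. i \<in> I \<Longrightarrow> 0 \<le> t \<Longrightarrow> (f i has_real_derivative g i t) (at t within {0..})"
    and bound: "\<And>i t. i \<in> I \<Longrightarrow> 0 \<le> t \<Longrightarrow> t \<le> T \<Longrightarrow> \<bar>g i t\<bar> \<le> C * (\<Sum>j\<in>I. \<bar>f j t\<bar>)"
    and C: "C \<ge> 0" and T: "T \<ge> 0"
    and init: "\<And>i. i \<in> I \<Longrightarrow> f i 0 = 0"
    and i: "i \<in> I"
  shows "f i T = 0"
proof -
  define E where "E t = (\<Sum>i\<in>I. (f i t)\<^sup>2)" for t
  \<comment> \<open>The 2 comes from differentiating squares, \<open>C\<close> from the hypothesis,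
    and \<open>card I\<close> from comparing the square of a sum with the sum of squares.\<close>
  define K where "K = 2 * C * card I"
  define h where "h t = E t * exp (- K * t)" for t
  have dE: "(E has_real_derivative (\<Sum>i\<in>I. 2 * f i t * g i t)) (at t within {0..})" if "0 \<le> t" for t
    unfolding E_def
    by (rule DERIV_sum) (use DERIV_power[OF d, of _ t 2] that in \<open>auto simp: mult_ac\<close>)
  have dh: "(h has_real_derivative
      ((\<Sum>i\<in>I. 2 * f i t * g i t) - K * E t) * exp (- K * t)) (at t within {0..})" if "0 \<le> t" for t
    unfolding h_def using that
    by (auto intro!: derivative_eq_intros dE simp: algebra_simps)
  have E': "(\<Sum>i\<in>I. 2 * f i t * g i t) \<le> K * E t" if t: "0 \<le> t" "t \<le> T" for t
  proof -
    let ?s = "\<Sum>j\<in>I. \<bar>f j t\<bar>"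
    have "(\<Sum>i\<in>I. 2 * f i t * g i t) \<le> (\<Sum>i\<in>I. 2 * \<bar>f i t\<bar> * (C * ?s))"
    proof (rule sum_mono)
      fix i assume "i \<in> I"
      have "2 * f i t * g i t \<le> 2 * (\<bar>f i t\<bar> * \<bar>g i t\<bar>)"
        by (simp flip: abs_mult)
      also have "\<dots> \<le> 2 * (\<bar>f i t\<bar> * (C * ?s))"
        using bound[OF \<open>i \<in> I\<close> t] by (intro mult_left_mono) auto
      finally show "2 * f i t * g i t \<le> 2 * \<bar>f i t\<bar> * (C * ?s)" by simp
    qed
    also have "\<dots> = 2 * C * ?s\<^sup>2"
      by (simp add: power2_eq_square mult_ac flip: sum_distrib_left sum_distrib_right)
    also have "\<dots> \<le> 2 * C * (card I * E t)"
    proof (rule mult_left_mono)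
      \<comment> \<open>The Cauchy-Schwarz inequality, obtained from the arithmetic-geometric mean
        inequality on each pair of indices.\<close>
      have "?s\<^sup>2 = (\<Sum>i\<in>I. \<Sum>j\<in>I. \<bar>f i t\<bar> * \<bar>f j t\<bar>)"
        by (simp add: power2_eq_square sum_product)
      also have "\<dots> \<le> (\<Sum>i\<in>I. \<Sum>j\<in>I. ((f i t)\<^sup>2 + (f j t)\<^sup>2) / 2)"
        using sum_squares_bound[of "\<bar>f _ t\<bar>" "\<bar>f _ t\<bar>"]
        by (intro sum_mono) (simp add: field_simps)
      also have "\<dots> = card I * E t"
        by (simp add: E_def sum.distrib add_divide_distrib flip: sum_divide_distrib sum_distrib_left)
      finally show "?s\<^sup>2 \<le> card I * E t" .
    qed (use C in simp)
    also have "\<dots> = K * E t" by (simp add: K_def)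
    finally show ?thesis .
  qed
  have "h T \<le> h 0"
  proof (rule DERIV_nonpos_imp_decreasing_open[OF T])
    fix t assume t: "0 < t" "t < T"
    \<comment> \<open>The monotonicity rule wants two-sided derivatives at interior points only; at
      the endpoints continuity is enough.\<close>
    then have "at t within {0..} = at t" by (intro at_within_open_subset[of _ "{0<..}"]) auto
    then have "(h has_real_derivative
        ((\<Sum>i\<in>I. 2 * f i t * g i t) - K * E t) * exp (- K * t)) (at t)"
      using dh[of t] t by simp
    moreover have "((\<Sum>i\<in>I. 2 * f i t * g i t) - K * E t) * exp (- K * t) \<le> 0"
      using E'[of t] t by (simp add: mult_le_0_iff)
    ultimately show "\<exists>y. DERIV h t :> y \<and> y \<le> 0" by blast
  next
    have "continuous_on {0..} h" by (rule DERIV_continuous_on) (use dh in auto)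
    then show "continuous_on {0..T} h" by (rule continuous_on_subset) auto
  qed
  moreover have "h 0 = 0" by (simp add: h_def E_def init)
  ultimately have "E T \<le> 0" by (simp add: h_def mult_le_0_iff)
  moreover have "(f i T)\<^sup>2 \<le> E T" unfolding E_def by (rule member_le_sum) (use i fin in auto)
  ultimately show ?thesis by (metis order_trans power2_less_eq_zero_iff)
qed

text \<open>The sum of the absolute values is continuous on the compact interval, and its maximum
  dominates every member of the family.\<close>

lemma common_bound_on_interval:
  fixes f :: "'i \<Rightarrow> real \<Rightarrow> real"
  assumes fin: "finite I" and cont: "\<And>i. i \<in> I \<Longrightarrow> continuous_on {0..} (f i)"
  obtains K where "K \<ge> 0" "\<And>i t. i \<in> I \<Longrightarrow> 0 \<le> t \<Longrightarrow> t \<le> T \<Longrightarrow> \<bar>f i t\<bar> \<le> K"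
proof (cases "0 \<le> T")
  case True
  define h where "h t = (\<Sum>i\<in>I. \<bar>f i t\<bar>)" for t
  have "continuous_on {0..T} h" unfolding h_def
    by (intro continuous_intros continuous_on_subset[OF cont]) auto
  then obtain t0 where "\<And>t. t \<in> {0..T} \<Longrightarrow> h t \<le> h t0"
    using continuous_attains_sup[of "{0..T}" h] True by fastforce
  moreover have "\<bar>f i t\<bar> \<le> h t" if "i \<in> I" for i t
    unfolding h_def by (rule member_le_sum[of i I "\<lambda>i. \<bar>f i t\<bar>"]) (use that fin in auto)
  moreover have "h t0 \<ge> 0" unfolding h_def by (simp add: sum_nonneg)
  ultimately show ?thesis using that[of "h t0"] by (meson atLeastAtMost_iff order_trans)
\<comment> \<open>For negative \<open>T\<close> there is no time to bound, so 0 will do.\<close>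
qed (use that[of 0] in auto)

text \<open>Uniqueness for a homogeneous linear equation: the Gronwall lemma for a family with one
  member, with \<open>C\<close> a bound of \<open>c\<close> on [0, t].\<close>

lemma linear_ode_zero:
  fixes f c :: "real \<Rightarrow> real"
  assumes d: "\<And>t. 0 \<le> t \<Longrightarrow> (f has_real_derivative c t * f t) (at t within {0..})"
    and c: "continuous_on {0..} c" and "f 0 = 0" "0 \<le> t"
  shows "f t = 0"
proof -
  obtain K where K: "K \<ge> 0" "\<And>i u. i \<in> {()} \<Longrightarrow> 0 \<le> u \<Longrightarrow> u \<le> t \<Longrightarrow> \<bar>c u\<bar> \<le> K"
    using common_bound_on_interval[of "{()}" "\<lambda>_. c" t] c by auto
  show ?thesis
    by (rule zero_of_growth_bound[of "{()}" "\<lambda>_. f" "\<lambda>_ t. c t * f t" t K])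
      (use assms K in \<open>auto simp: abs_mult mult_right_mono\<close>)
qed

section \<open>The closed form for one mode\<close>

text \<open>\<open>linear_ode_zero\<close> is used twice: on a - b, which gives balance at all
  times, and then on the closed form with its denominator cleared.\<close>

lemma single_mode_solution:
  fixes a b :: "real \<Rightarrow> real"
  assumes da: "\<And>t. 0 \<le> t \<Longrightarrow>
      (a has_real_derivative (s - a t * b t) * b t / \<tau>) (at t within {0..})"
    and db: "\<And>t. 0 \<le> t \<Longrightarrow>
      (b has_real_derivative a t * (s - a t * b t) / \<tau>) (at t within {0..})"
    and init: "a 0 = b 0" "a 0 \<noteq> 0" and s: "s > 0" and tau: "\<tau> > 0" and t: "0 \<le> t"
  shows "a t * b t = s * exp (2 * s * t / \<tau>) / (exp (2 * s * t / \<tau>) - 1 + s / (a 0 * b 0))"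
proof -
  have ca: "continuous_on {0..} a" by (rule DERIV_continuous_on) (use da in auto)
  have cb: "continuous_on {0..} b" by (rule DERIV_continuous_on) (use db in auto)
  have ab: "a t = b t" if t: "0 \<le> t" for t
  proof -
    have "a t - b t = 0"
    proof (rule linear_ode_zero[where f = "\<lambda>t. a t - b t" and c = "\<lambda>t. - (s - a t * b t) / \<tau>"])
      show "((\<lambda>t. a t - b t) has_real_derivative - (s - a t * b t) / \<tau> * (a t - b t))
          (at t within {0..})" if "0 \<le> t" for t
        by (rule derivative_eq_intros da db refl that)+
          (use tau in \<open>simp add: field_simps\<close>)
      show "continuous_on {0..} (\<lambda>t. - (s - a t * b t) / \<tau>)"
        using ca cb tau by (intro continuous_intros) auto
    qed (use init t in auto)
    then show ?thesis by simp
  qed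
  define e where "e t = exp (2 * s * t / \<tau>)" for t
  define r where "r = s / (a 0 * b 0)"
  define d where "d t = e t - 1 + r" for t
  have de: "(e has_real_derivative 2 * s / \<tau> * e t) (at t within {0..})" for t
    unfolding e_def using tau by (auto intro!: derivative_eq_intros)
  have ce: "continuous_on {0..} e" by (rule DERIV_continuous_on) (use de in auto)
  have "a t * b t * d t - s * e t = 0"
  proof (rule linear_ode_zero[where f = "\<lambda>t. a t * b t * d t - s * e t"
        and c = "\<lambda>t. 2 / \<tau> * (s - a t * b t)"])
    show "((\<lambda>t. a t * b t * d t - s * e t) has_real_derivative
        2 / \<tau> * (s - a t * b t) * (a t * b t * d t - s * e t)) (at t within {0..})"
      if t: "0 \<le> t" for t
      unfolding d_def
      by (rule derivative_eq_intros da db de refl t)+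
        \<comment> \<open>The derivative of a b carries the factor a^2 + b^2, which balance turns
          into 2 a b.\<close>
        (use tau ab[OF t] in \<open>simp add: field_simps\<close>)
    show "continuous_on {0..} (\<lambda>t. 2 / \<tau> * (s - a t * b t))"
      using ca cb by (intro continuous_intros)
    show "a 0 * b 0 * d 0 - s * e 0 = 0" using init by (simp add: d_def e_def r_def)
  qed (rule t)
  \<comment> \<open>This permits the division by \<open>d t\<close>. Balance at time 0 makes the
    initial strength a square, hence positive.\<close>
  moreover have "d t > 0"
  proof -
    have "e t \<ge> 1" using s tau t by (simp add: e_def)
    moreover have "s / (a 0 * b 0) > 0"
      using init s by (metis divide_pos_pos not_real_square_gt_zero)
    ultimately show ?thesis by (simp add: d_def r_def)
  qed
  ultimately have "a t * b t = s * e t / d t" by (simp add: field_simps)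
  then show ?thesis by (simp only: d_def e_def r_def)
qed

section \<open>Decoupling of the modes\<close>

text \<open>Off the diagonal, every monomial of \<open>(S - p q) q\<^sup>T\<close> contains an off-diagonal factor.\<close>

lemma offdiag_flow_bound:
  fixes S p q :: "nat \<Rightarrow> nat \<Rightarrow> real"
  assumes i: "i < m" and k: "k < h" and ik: "i \<noteq> k"
    and S: "\<And>i j. i < m \<Longrightarrow> j < n \<Longrightarrow> i \<noteq> j \<Longrightarrow> S i j = 0"
    and Sb: "\<And>i j. i < m \<Longrightarrow> j < n \<Longrightarrow> \<bar>S i j\<bar> \<le> K"
    and pb: "\<And>i l. i < m \<Longrightarrow> l < h \<Longrightarrow> \<bar>p i l\<bar> \<le> K"
    and qb: "\<And>l j. l < h \<Longrightarrow> j < n \<Longrightarrow> \<bar>q l j\<bar> \<le> K"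
    and pE: "\<And>i l. i < m \<Longrightarrow> l < h \<Longrightarrow> i \<noteq> l \<Longrightarrow> \<bar>p i l\<bar> \<le> E"
    and qE: "\<And>l j. l < h \<Longrightarrow> j < n \<Longrightarrow> l \<noteq> j \<Longrightarrow> \<bar>q l j\<bar> \<le> E"
    and K: "K \<ge> 0" and E: "E \<ge> 0"
  shows "\<bar>\<Sum>j<n. (S i j - (\<Sum>l<h. p i l * q l j)) * q k j\<bar> \<le> real n * (K + real h * (K * K)) * E"
proof -
  \<comment> \<open>The \<open>S\<close> term contributes K E, and each of the \<open>h\<close>
    products contributes K^2 E.\<close>
  have "\<bar>(S i j - (\<Sum>l<h. p i l * q l j)) * q k j\<bar> \<le> (K + real h * (K * K)) * E" if j: "j < n" for j
  proof -
    have 1: "\<bar>S i j * q k j\<bar> \<le> K * E"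
    proof (cases "i = j")
      case True
      then show ?thesis unfolding abs_mult using Sb[OF i j] qE[OF k j] ik K by (intro mult_mono) auto
    qed (use S[OF i j] K E in simp)
    have 2: "\<bar>p i l * q l j * q k j\<bar> \<le> K * K * E" if l: "l < h" for l
    proof -
      \<comment> \<open>If all three failed, then i = l = j = k, against \<open>ik\<close>. Each
        case names the factor that is off the diagonal and so bounded by \<open>E\<close>.\<close>
      consider "i \<noteq> l" | "l \<noteq> j" | "k \<noteq> j" using ik by blast
      then show ?thesis
      proof cases
        case 1
        have "\<bar>p i l\<bar> * \<bar>q l j\<bar> * \<bar>q k j\<bar> \<le> E * K * K"
          using pE[OF i l 1] qb[OF l j] qb[OF k j] K E by (intro mult_mono) auto
        then show ?thesis by (simp add: abs_mult mult_ac)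
      next
        case 2
        have "\<bar>p i l\<bar> * \<bar>q l j\<bar> * \<bar>q k j\<bar> \<le> K * E * K"
          using pb[OF i l] qE[OF l j 2] qb[OF k j] K E by (intro mult_mono) auto
        then show ?thesis by (simp add: abs_mult mult_ac)
      next
        case 3
        have "\<bar>p i l\<bar> * \<bar>q l j\<bar> * \<bar>q k j\<bar> \<le> K * K * E"
          using pb[OF i l] qb[OF l j] qE[OF k j 3] K E by (intro mult_mono) auto
        then show ?thesis by (simp add: abs_mult)
      qed
    qed
    have "\<bar>(S i j - (\<Sum>l<h. p i l * q l j)) * q k j\<bar>
        \<le> \<bar>S i j * q k j\<bar> + \<bar>\<Sum>l<h. p i l * q l j * q k j\<bar>"
      unfolding left_diff_distrib sum_distrib_right by (rule abs_triangle_ineq4)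
    also have "\<bar>\<Sum>l<h. p i l * q l j * q k j\<bar> \<le> (\<Sum>l<h. K * K * E)"
      using 2 by (intro order_trans[OF sum_abs] sum_mono) auto
    also have "\<bar>S i j * q k j\<bar> \<le> K * E" by (rule 1)
    finally show ?thesis by (simp add: algebra_simps)
  qed
  then have "\<bar>\<Sum>j<n. (S i j - (\<Sum>l<h. p i l * q l j)) * q k j\<bar> \<le> (\<Sum>j<n. (K + real h * (K * K)) * E)"
    by (intro order_trans[OF sum_abs] sum_mono) auto
  then show ?thesis by (simp add: mult_ac)
qed

text \<open>The off-diagonal entries of both factors form one finite family that starts at 0. On
  [0, T] all entries are bounded, so \<open>offdiag_flow_bound\<close> supplies the growth
  hypothesis of \<open>zero_of_growth_bound\<close>.\<close>

lemma flow_stays_diagonal: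
  fixes S :: "nat \<Rightarrow> nat \<Rightarrow> real" and a b :: "nat \<Rightarrow> nat \<Rightarrow> real \<Rightarrow> real"
  assumes da: "\<And>i k t. i < m \<Longrightarrow> k < h \<Longrightarrow> 0 \<le> t \<Longrightarrow> (a i k has_real_derivative
        c * (\<Sum>j<n. (S i j - (\<Sum>l<h. a i l t * b l j t)) * b k j t)) (at t within {0..})"
    and db: "\<And>k j t. k < h \<Longrightarrow> j < n \<Longrightarrow> 0 \<le> t \<Longrightarrow> (b k j has_real_derivative
        c * (\<Sum>i<m. a i k t * (S i j - (\<Sum>l<h. a i l t * b l j t)))) (at t within {0..})"
    and S: "\<And>i j. i < m \<Longrightarrow> j < n \<Longrightarrow> i \<noteq> j \<Longrightarrow> S i j = 0"
    and a0: "\<And>i k. i < m \<Longrightarrow> k < h \<Longrightarrow> i \<noteq> k \<Longrightarrow> a i k 0 = 0"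
    and b0: "\<And>k j. k < h \<Longrightarrow> j < n \<Longrightarrow> k \<noteq> j \<Longrightarrow> b k j 0 = 0"
    and T: "0 \<le> T"
  shows "i < m \<Longrightarrow> k < h \<Longrightarrow> i \<noteq> k \<Longrightarrow> a i k T = 0"
    and "k < h \<Longrightarrow> j < n \<Longrightarrow> k \<noteq> j \<Longrightarrow> b k j T = 0"
proof -
  have ca: "continuous_on {0..} (a i k)" if "i < m" "k < h" for i k
    by (rule DERIV_continuous_on) (use da[OF that] in auto)
  have cb: "continuous_on {0..} (b k j)" if "k < h" "j < n" for k j
    by (rule DERIV_continuous_on) (use db[OF that] in auto)
  obtain Ka where Ka: "Ka \<ge> 0"
    "\<And>x t. x \<in> {..<m} \<times> {..<h} \<Longrightarrow> 0 \<le> t \<Longrightarrow> t \<le> T \<Longrightarrow> \<bar>case_prod a x t\<bar> \<le> Ka"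
    by (rule common_bound_on_interval[of "{..<m} \<times> {..<h}" "case_prod a"]) (use ca in auto)
  obtain Kb where Kb: "Kb \<ge> 0"
    "\<And>x t. x \<in> {..<h} \<times> {..<n} \<Longrightarrow> 0 \<le> t \<Longrightarrow> t \<le> T \<Longrightarrow> \<bar>case_prod b x t\<bar> \<le> Kb"
    by (rule common_bound_on_interval[of "{..<h} \<times> {..<n}" "case_prod b"]) (use cb in auto)
  obtain Ks where Ks: "Ks \<ge> 0"
    "\<And>x t. x \<in> {..<m} \<times> {..<n} \<Longrightarrow> 0 \<le> t \<Longrightarrow> t \<le> T \<Longrightarrow> \<bar>case_prod S x\<bar> \<le> Ks"
    by (rule common_bound_on_interval[of "{..<m} \<times> {..<n}" "\<lambda>x _. case_prod S x"]) auto
  define K where "K = Ka + Kb + Ks"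
  have K: "K \<ge> 0"
    and aK: "\<And>i k t. i < m \<Longrightarrow> k < h \<Longrightarrow> 0 \<le> t \<Longrightarrow> t \<le> T \<Longrightarrow> \<bar>a i k t\<bar> \<le> K"
    and bK: "\<And>k j t. k < h \<Longrightarrow> j < n \<Longrightarrow> 0 \<le> t \<Longrightarrow> t \<le> T \<Longrightarrow> \<bar>b k j t\<bar> \<le> K"
    and sK: "\<And>i j. i < m \<Longrightarrow> j < n \<Longrightarrow> \<bar>S i j\<bar> \<le> K"
    unfolding K_def using Ka Kb Ks T by fastforce+
  \<comment> \<open>The disjoint sum keeps entry (i, k) of \<open>a\<close> apart from entry (i, k)
    of \<open>b\<close>.\<close>
  define I where "I = {x \<in> {..<m} \<times> {..<h}. fst x \<noteq> snd x} <+> {x \<in> {..<h} \<times> {..<n}. fst x \<noteq> snd x}"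
  define f where "f = case_sum (case_prod a) (case_prod b)"
  \<comment> \<open>The products in the second branch are commuted, so that it is the first branch
    for the transposed problem with \<open>a\<close> and \<open>b\<close> exchanged.\<close>
  define g where "g = case_sum
     (\<lambda>(i, k) t. c * (\<Sum>j<n. (S i j - (\<Sum>l<h. a i l t * b l j t)) * b k j t))
     (\<lambda>(k, j) t. c * (\<Sum>i<m. (S i j - (\<Sum>l<h. b l j t * a i l t)) * a i k t))"
  \<comment> \<open>The estimate has the factor \<open>n\<close> for entries of \<open>a\<close> and
    \<open>m\<close> for entries of \<open>b\<close>; the sum m + n covers both.\<close>
  define C where "C = \<bar>c\<bar> * ((real m + real n) * (K + real h * (K * K)))"
  have C: "C \<ge> 0" using K by (simp add: C_def)
  have fin: "finite I" by (simp add: I_def)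
  have d: "(f x has_real_derivative g x t) (at t within {0..})" if "x \<in> I" "0 \<le> t" for x t
    using that da db unfolding I_def f_def g_def by (auto simp: mult.commute)
  have f0: "f x 0 = 0" if "x \<in> I" for x
    using that a0 b0 unfolding I_def f_def by auto
  have bound: "\<bar>g x t\<bar> \<le> C * (\<Sum>y\<in>I. \<bar>f y t\<bar>)" if x: "x \<in> I" and t: "0 \<le> t" "t \<le> T" for x t
  proof -
    let ?E = "\<Sum>y\<in>I. \<bar>f y t\<bar>"
    have E0: "?E \<ge> 0" by (simp add: sum_nonneg)
    have fE: "\<bar>f y t\<bar> \<le> ?E" if "y \<in> I" for y
      by (rule member_le_sum[of y I "\<lambda>y. \<bar>f y t\<bar>"]) (use that fin in auto)
    have aE: "\<bar>a i k t\<bar> \<le> ?E" if "i < m" "k < h" "i \<noteq> k" for i k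
      using fE[of "Inl (i, k)"] that by (simp add: InlI I_def f_def)
    have bE: "\<bar>b k j t\<bar> \<le> ?E" if "k < h" "j < n" "k \<noteq> j" for k j
      using fE[of "Inr (k, j)"] that by (simp add: InrI I_def f_def)
    have scale: "\<bar>c * z\<bar> \<le> C * ?E"
      if "\<bar>z\<bar> \<le> real r * (K + real h * (K * K)) * ?E" "r \<le> m + n" for z r
    proof -
      have "\<bar>c * z\<bar> \<le> \<bar>c\<bar> * (real r * (K + real h * (K * K)) * ?E)"
        unfolding abs_mult using that by (intro mult_left_mono) auto
      also have "\<dots> \<le> \<bar>c\<bar> * ((real m + real n) * (K + real h * (K * K)) * ?E)"
        using that K E0 by (intro mult_left_mono mult_right_mono) auto
      finally show ?thesis by (simp add: C_def mult_ac)
    qed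
    from x consider i k where "x = Inl (i, k)" "i < m" "k < h" "i \<noteq> k"
      | k j where "x = Inr (k, j)" "k < h" "j < n" "k \<noteq> j"
      by (auto simp: I_def)
    then show ?thesis
    proof cases
      case 1
      have "\<bar>\<Sum>j<n. (S i j - (\<Sum>l<h. a i l t * b l j t)) * b k j t\<bar>
          \<le> real n * (K + real h * (K * K)) * ?E"
        by (rule offdiag_flow_bound[where m = m and p = "\<lambda>i l. a i l t" and q = "\<lambda>l j. b l j t"])
          (use 1 S sK aK bK aE bE K E0 t in auto)
      from scale[OF this] show ?thesis by (simp add: 1 g_def)
    next
      case 2
      have "\<bar>\<Sum>i<m. (S i j - (\<Sum>l<h. b l j t * a i l t)) * a i k t\<bar>
          \<le> real m * (K + real h * (K * K)) * ?E"
        by (rule offdiag_flow_bound[where m = n and S = "\<lambda>j i. S i j"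
              and p = "\<lambda>j l. b l j t" and q = "\<lambda>l i. a i l t"])
          (use 2 S sK aK bK aE bE K E0 t in auto)
      from scale[OF this] show ?thesis by (simp add: 2 g_def)
    qed
  qed
  have zero: "f x T = 0" if "x \<in> I" for x
    by (rule zero_of_growth_bound[OF fin d bound C T f0 that])
  show "i < m \<Longrightarrow> k < h \<Longrightarrow> i \<noteq> k \<Longrightarrow> a i k T = 0"
    using zero[of "Inl (i, k)"] by (simp add: InlI I_def f_def)
  show "k < h \<Longrightarrow> j < n \<Longrightarrow> k \<noteq> j \<Longrightarrow> b k j T = 0"
    using zero[of "Inr (k, j)"] by (simp add: InrI I_def f_def)
qed

section \<open>Matrix derivatives and orthogonal changes of coordinates\<close>

lemma index_mult_mat_sum:
  assumes "X \<in> carrier_mat a n" "Y \<in> carrier_mat n b" "i < a" "j < b"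
  shows "(X * Y) $$ (i, j) = (\<Sum>k<n. X $$ (i, k) * Y $$ (k, j))"
  using assms by (auto simp: scalar_prod_def atLeast0LessThan intro!: sum.cong)

lemma has_mat_derivative_mult_left:
  assumes W: "has_mat_derivative W G (at t within T)" "\<And>u. u \<in> T \<Longrightarrow> W u \<in> carrier_mat m n"
    and G: "G \<in> carrier_mat m n" and X: "X \<in> carrier_mat r m" and t: "t \<in> T"
  shows "has_mat_derivative (\<lambda>u. X * W u) (X * G) (at t within T)"
  unfolding has_mat_derivative_def
proof (intro allI impI)
  fix i j assume "i < dim_row (X * G)" "j < dim_col (X * G)"
  then have ij: "i < r" "j < n" using X G by auto
  have "((\<lambda>u. \<Sum>k<m. X $$ (i, k) * W u $$ (k, j)) has_real_derivative
      (\<Sum>k<m. X $$ (i, k) * G $$ (k, j))) (at t within T)"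
    using W(1) G ij by (intro DERIV_sum DERIV_cmult) (auto simp: has_mat_derivative_def)
  then have "((\<lambda>u. \<Sum>k<m. X $$ (i, k) * W u $$ (k, j)) has_real_derivative (X * G) $$ (i, j))
      (at t within T)"
    by (simp only: index_mult_mat_sum[OF X G ij])
  \<comment> \<open>The product entry is known to equal the sum only for times in \<open>T\<close>,
    where the shape of \<open>W u\<close> is known. The equality holds on all of \<open>T\<close>,
    so any radius would do.\<close>
  then show "((\<lambda>u. (X * W u) $$ (i, j)) has_real_derivative (X * G) $$ (i, j)) (at t within T)"
    by (rule has_field_derivative_transform_within[where d = 1])
      (use t in \<open>auto simp: index_mult_mat_sum[OF X W(2) ij] simp del: index_mult_mat\<close>)
qed

lemma has_mat_derivative_mult_right:
  assumes W: "has_mat_derivative W G (at t within T)" "\<And>u. u \<in> T \<Longrightarrow> W u \<in> carrier_mat m n"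
    and G: "G \<in> carrier_mat m n" and Y: "Y \<in> carrier_mat n r" and t: "t \<in> T"
  shows "has_mat_derivative (\<lambda>u. W u * Y) (G * Y) (at t within T)"
  unfolding has_mat_derivative_def
proof (intro allI impI)
  fix i j assume "i < dim_row (G * Y)" "j < dim_col (G * Y)"
  then have ij: "i < m" "j < r" using Y G by auto
  have "((\<lambda>u. \<Sum>k<n. W u $$ (i, k) * Y $$ (k, j)) has_real_derivative
      (\<Sum>k<n. G $$ (i, k) * Y $$ (k, j))) (at t within T)"
    using W(1) G ij by (intro DERIV_sum DERIV_cmult_right) (auto simp: has_mat_derivative_def)
  then have "((\<lambda>u. \<Sum>k<n. W u $$ (i, k) * Y $$ (k, j)) has_real_derivative (G * Y) $$ (i, j))
      (at t within T)"
    by (simp only: index_mult_mat_sum[OF G Y ij])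
  then show "((\<lambda>u. (W u * Y) $$ (i, j)) has_real_derivative (G * Y) $$ (i, j)) (at t within T)"
    by (rule has_field_derivative_transform_within[where d = 1])
      (use t in \<open>auto simp: index_mult_mat_sum[OF W(2) Y ij] simp del: index_mult_mat\<close>)
qed

lemma has_mat_derivative_conjugate:
  assumes W: "has_mat_derivative W (c \<cdot>\<^sub>m G) (at t within T)" "\<And>u. u \<in> T \<Longrightarrow> W u \<in> carrier_mat m n"
    and G: "G \<in> carrier_mat m n" and X: "X \<in> carrier_mat r m" and Y: "Y \<in> carrier_mat n q"
    and t: "t \<in> T"
  shows "has_mat_derivative (\<lambda>u. X * W u * Y) (c \<cdot>\<^sub>m (X * G * Y)) (at t within T)"
proof -
  have cG: "c \<cdot>\<^sub>m G \<in> carrier_mat m n" using G by (rule smult_carrier_mat)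
  have "has_mat_derivative (\<lambda>u. X * W u * Y) (X * (c \<cdot>\<^sub>m G) * Y) (at t within T)"
    by (rule has_mat_derivative_mult_right[OF has_mat_derivative_mult_left[OF W cG X t]
          mult_carrier_mat[OF X W(2)] mult_carrier_mat[OF X cG] Y t])
  also have "X * (c \<cdot>\<^sub>m G) * Y = c \<cdot>\<^sub>m (X * G * Y)"
    by (simp only: mult_smult_distrib[OF X G] mult_smult_assoc_mat[OF mult_carrier_mat[OF X G] Y])
  finally show ?thesis .
qed

text \<open>Dimension equations as side conditions let the simplifier reassociate unaided; with
  carrier premises it would have to guess sizes. The same holds for
  \<open>transpose_mult_dim\<close>.\<close>

lemma assoc_mult_mat_dim:
  fixes A B C :: "real mat"
  assumes "dim_col A = dim_row B" "dim_col B = dim_row C"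
  shows "A * B * C = A * (B * C)"
  by (rule assoc_mult_mat) (use assms in \<open>auto intro: carrier_matI\<close>)

lemma transpose_mult_dim:
  fixes A B :: "real mat"
  assumes "dim_col A = dim_row B"
  shows "(A * B)\<^sup>T = B\<^sup>T * A\<^sup>T"
  by (rule transpose_mult) (use assms in \<open>auto intro: carrier_matI\<close>)

text \<open>The trailing factor \<open>X\<close> lets these rules fire inside products that are
  associated to the right.\<close>

lemma real_orthogonal_mat_cancel:
  assumes "real_orthogonal_mat n U" "dim_row X = n"
  shows "U\<^sup>T * (U * X) = X" and "U * (U\<^sup>T * X) = X"
proof -
  have U: "U \<in> carrier_mat n n" and UU: "U\<^sup>T * U = 1\<^sub>m n" "U * U\<^sup>T = 1\<^sub>m n"
    using assms(1) by (auto simp: real_orthogonal_mat_def)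
  have X: "X \<in> carrier_mat n (dim_col X)" using assms(2) by auto
  show "U\<^sup>T * (U * X) = X" "U * (U\<^sup>T * X) = X"
    using U X by (simp_all add: UU flip: assoc_mult_mat_dim)
qed

text \<open>\<open>U\<close> and \<open>V\<close> cancel around the target, and
  \<open>Q * Q\<^sup>T\<close> is the identity between the two layers, so the rotated residual has
  the same shape with \<open>S\<close> as target.\<close>

lemma conjugated_residual:
  assumes U: "real_orthogonal_mat Ny U" and V: "real_orthogonal_mat Nx V"
    and Q: "real_orthogonal_mat Nh Q"
    and S: "S \<in> carrier_mat Ny Nx"
    and W1: "W1 \<in> carrier_mat Nh Nx" and W2: "W2 \<in> carrier_mat Ny Nh"
  shows "U\<^sup>T * (U * S * V\<^sup>T - W2 * W1) * V = S - (U\<^sup>T * W2 * Q) * (Q\<^sup>T * W1 * V)"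
proof -
  note c [simp] = U[unfolded real_orthogonal_mat_def, THEN conjunct1, THEN carrier_matD(1)]
    U[unfolded real_orthogonal_mat_def, THEN conjunct1, THEN carrier_matD(2)]
    V[unfolded real_orthogonal_mat_def, THEN conjunct1, THEN carrier_matD(1)]
    V[unfolded real_orthogonal_mat_def, THEN conjunct1, THEN carrier_matD(2)]
    Q[unfolded real_orthogonal_mat_def, THEN conjunct1, THEN carrier_matD(1)]
    Q[unfolded real_orthogonal_mat_def, THEN conjunct1, THEN carrier_matD(2)]
    carrier_matD[OF S] carrier_matD[OF W1] carrier_matD[OF W2]
  have "U\<^sup>T * (U * S * V\<^sup>T - W2 * W1) = U\<^sup>T * (U * S * V\<^sup>T) - U\<^sup>T * (W2 * W1)"
    by (rule mult_minus_distrib_mat) (auto intro!: carrier_matI)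
  moreover have "(U\<^sup>T * (U * S * V\<^sup>T) - U\<^sup>T * (W2 * W1)) * V
      = U\<^sup>T * (U * S * V\<^sup>T) * V - U\<^sup>T * (W2 * W1) * V"
    by (rule minus_mult_distrib_mat) (auto intro!: carrier_matI)
  \<comment> \<open>Here \<open>V\<close> ends the product, so the cancellation rules, which need a
    further factor, do not apply.\<close>
  moreover have "S * (V\<^sup>T * V) = S"
    using V S by (simp add: real_orthogonal_mat_def)
  ultimately show ?thesis
    by (simp add: assoc_mult_mat_dim real_orthogonal_mat_cancel[OF U] real_orthogonal_mat_cancel[OF Q])
qed

section \<open>The matrix flow in singular coordinates\<close>

text \<open>\<open>F\<close> varies with time while \<open>U\<close> and \<open>V\<close> do not:
  the update stays diagonal in the singular bases of the target. The formula is claimed for balanced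
  modes, since otherwise a^2 + b^2 replaces 2 u in the equation for u = a b. The conditions on
  \<open>u0\<close> and \<open>s\<close> exclude the degenerate cases, where division by zero would
  give the formula a spurious value.\<close>

theorem theorem2:
  fixes Nx Nh Ny P :: nat
    and x y :: "nat \<Rightarrow> real vec"
    and U V Q S M1 M2 :: "real mat"
    and W1 W2 :: "real \<Rightarrow> real mat"
    and \<tau> :: real
  assumes dims: "Nh < Nx" "Nh < Ny"
    and x: "\<And>i. i < P \<Longrightarrow> x i \<in> carrier_vec Nx"
    and y: "\<And>i. i < P \<Longrightarrow> y i \<in> carrier_vec Ny"
    and orth: "\<And>i j. i < P \<Longrightarrow> j < P \<Longrightarrow> i \<noteq> j \<Longrightarrow> x i \<bullet> x j = 0"
    and white: "correlation_mat Nx Nx P x x = 1\<^sub>m Nx"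
    and svd: "singular_value_decomposition Ny Nx (correlation_mat Ny Nx P y x) U S V"
    and Q: "real_orthogonal_mat Nh Q"
    and M2: "M2 \<in> carrier_mat Ny Nh" "diagonal_mat M2"
    and M1: "M1 \<in> carrier_mat Nh Nx" "diagonal_mat M1"
    and tau: "\<tau> > 0"
    and flow: "gradient_flow Nx Nh Ny \<tau>
                 (correlation_mat Nx Nx P x x) (correlation_mat Ny Nx P y x) W1 W2"
    and init: "W2 0 = U * M2 * Q\<^sup>T" "W1 0 = Q * M1 * V\<^sup>T"
  shows "\<forall>t\<ge>0. \<exists>F. mode_decomposition Ny Nx (W2 t * W1 t - W2 0 * W1 0) U F V \<and>
           (\<forall>\<alpha><Nh. let s = S $$ (\<alpha>, \<alpha>); u0 = (M2 * M1) $$ (\<alpha>, \<alpha>); uf = F $$ (\<alpha>, \<alpha>) in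
              M2 $$ (\<alpha>, \<alpha>) = M1 $$ (\<alpha>, \<alpha>) \<and> u0 \<noteq> 0 \<and> s \<noteq> 0 \<longrightarrow>
              uf = s * exp (2 * s * t / \<tau>) / (exp (2 * s * t / \<tau>) - 1 + s / u0) - u0)"
proof (intro allI impI)
  fix T :: real assume T: "0 \<le> T"
  define Z where "Z = correlation_mat Ny Nx P y x"
  have U: "real_orthogonal_mat Ny U" and V: "real_orthogonal_mat Nx V"
    and S: "S \<in> carrier_mat Ny Nx" "diagonal_mat S" and Z: "Z = U * S * V\<^sup>T"
    and S0: "\<And>i. i < min Ny Nx \<Longrightarrow> S $$ (i, i) \<ge> 0"
    using svd by (auto simp: singular_value_decomposition_def mode_decomposition_def Z_def)
  have Uc: "U \<in> carrier_mat Ny Ny" and Vc: "V \<in> carrier_mat Nx Nx" and Qc: "Q \<in> carrier_mat Nh Nh"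
    using U V Q by (auto simp: real_orthogonal_mat_def)
  have VV: "V\<^sup>T * V = 1\<^sub>m Nx" and QQ: "Q\<^sup>T * Q = 1\<^sub>m Nh"
    using U V Q by (auto simp: real_orthogonal_mat_def)
  note dim [simp] = carrier_matD[OF Uc] carrier_matD[OF Vc] carrier_matD[OF Qc] carrier_matD[OF S(1)]
    carrier_matD[OF M1(1)] carrier_matD[OF M2(1)]
  note cancel = real_orthogonal_mat_cancel[OF U] real_orthogonal_mat_cancel[OF V]
    real_orthogonal_mat_cancel[OF Q]
  define A where "A t = U\<^sup>T * W2 t * Q" for t
  define B where "B t = Q\<^sup>T * W1 t * V" for t
  have W1c: "W1 t \<in> carrier_mat Nh Nx" and W2c: "W2 t \<in> carrier_mat Ny Nh" if "0 \<le> t" for t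
    using flow that by (auto simp: gradient_flow_def)
  have Ac: "A t \<in> carrier_mat Ny Nh" and Bc: "B t \<in> carrier_mat Nh Nx" if "0 \<le> t" for t
    using W1c[OF that] W2c[OF that] by (auto simp: A_def B_def intro!: carrier_matI)
  define c where "c = 1 / \<tau>"
  have dA: "has_mat_derivative A (c \<cdot>\<^sub>m ((S - A t * B t) * (B t)\<^sup>T)) (at t within {0..})"
    and dB: "has_mat_derivative B (c \<cdot>\<^sub>m ((A t)\<^sup>T * (S - A t * B t))) (at t within {0..})"
    if t: "0 \<le> t" for t
  proof -
    note w [simp] = carrier_matD[OF W1c[OF t]] carrier_matD[OF W2c[OF t]]
    define R where "R = Z - W2 t * W1 t"
    have Rc: "R \<in> carrier_mat Ny Nx" by (auto simp: R_def intro!: carrier_matI)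
    note r [simp] = carrier_matD[OF Rc]
    have SAB: "S - A t * B t = U\<^sup>T * R * V"
      unfolding A_def B_def R_def Z
      by (rule conjugated_residual[OF U V Q S(1) W1c[OF t] W2c[OF t], symmetric])
    \<comment> \<open>Whitened inputs remove the right factor, which makes \<open>R\<close> the
      residual in both equations.\<close>
    have "W2 t * W1 t * 1\<^sub>m Nx = W2 t * W1 t"
      by (rule right_mult_one_mat[of _ Ny]) (auto intro!: carrier_matI)
    then have d1: "has_mat_derivative W1 (c \<cdot>\<^sub>m ((W2 t)\<^sup>T * R)) (at t within {0..})"
      and d2: "has_mat_derivative W2 (c \<cdot>\<^sub>m (R * (W1 t)\<^sup>T)) (at t within {0..})"
      using flow t by (auto simp: gradient_flow_def white R_def Z_def c_def)
    have g1: "(W2 t)\<^sup>T * R \<in> carrier_mat Nh Nx" and g2: "R * (W1 t)\<^sup>T \<in> carrier_mat Ny Nh"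
      by (auto intro!: carrier_matI)
    have "has_mat_derivative A (c \<cdot>\<^sub>m (U\<^sup>T * (R * (W1 t)\<^sup>T) * Q)) (at t within {0..})"
      unfolding A_def
      by (rule has_mat_derivative_conjugate[OF d2 _ g2 _ Qc]) (use W2c Uc t in auto)
    \<comment> \<open>The \<open>V\<close> of the rotated residual meets the
      \<open>V\<^sup>T\<close> of the transposed \<open>B t\<close>. \<open>SAB\<close> is applied
      first because unfolding \<open>B\<close> would destroy its left-hand side.\<close>
    also have "U\<^sup>T * (R * (W1 t)\<^sup>T) * Q = (S - A t * B t) * (B t)\<^sup>T"
      by (simp add: SAB, simp add: B_def assoc_mult_mat_dim transpose_mult_dim cancel)
    finally show "has_mat_derivative A (c \<cdot>\<^sub>m ((S - A t * B t) * (B t)\<^sup>T)) (at t within {0..})" .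
    have "has_mat_derivative B (c \<cdot>\<^sub>m (Q\<^sup>T * ((W2 t)\<^sup>T * R) * V)) (at t within {0..})"
      unfolding B_def
      by (rule has_mat_derivative_conjugate[OF d1 _ g1 _ Vc]) (use W1c Qc t in auto)
    also have "Q\<^sup>T * ((W2 t)\<^sup>T * R) * V = (A t)\<^sup>T * (S - A t * B t)"
      by (simp add: SAB, simp add: A_def assoc_mult_mat_dim transpose_mult_dim cancel)
    finally show "has_mat_derivative B (c \<cdot>\<^sub>m ((A t)\<^sup>T * (S - A t * B t))) (at t within {0..})" .
  qed
  have A0: "A 0 = M2" and B0: "B 0 = M1"
    unfolding A_def B_def init using M1 M2
    by (simp_all add: assoc_mult_mat_dim cancel VV QQ)
  have SAB: "(S - A t * B t) $$ (i, j) = S $$ (i, j) - (\<Sum>l<Nh. A t $$ (i, l) * B t $$ (l, j))"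
    if "0 \<le> t" "i < Ny" "j < Nx" for t i j
    using index_mult_mat_sum[OF Ac Bc, OF that(1,1,2,3)] Ac[OF that(1)] Bc[OF that(1)] that
    by (simp del: index_mult_mat(1))
  have SABc: "S - A t * B t \<in> carrier_mat Ny Nx" if "0 \<le> t" for t
    using Ac[OF that] Bc[OF that] by (auto intro!: carrier_matI)
  have dAe: "((\<lambda>t. A t $$ (i, k)) has_real_derivative c * (\<Sum>j<Nx.
      (S $$ (i, j) - (\<Sum>l<Nh. A t $$ (i, l) * B t $$ (l, j))) * B t $$ (k, j))) (at t within {0..})"
    if ik: "i < Ny" "k < Nh" and t: "0 \<le> t" for i k t
  proof -
    have "((\<lambda>t. A t $$ (i, k)) has_real_derivative
        (c \<cdot>\<^sub>m ((S - A t * B t) * (B t)\<^sup>T)) $$ (i, k)) (at t within {0..})"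
      using dA[OF t] ik Ac[OF t] Bc[OF t] by (simp add: has_mat_derivative_def del: index_mult_mat(1))
    moreover have "((S - A t * B t) * (B t)\<^sup>T) $$ (i, k) = (\<Sum>j<Nx.
        (S $$ (i, j) - (\<Sum>l<Nh. A t $$ (i, l) * B t $$ (l, j))) * B t $$ (k, j))"
      using index_mult_mat_sum[OF SABc[OF t], of "(B t)\<^sup>T" Nh i k] ik t Bc[OF t]
      by (simp add: SAB del: index_mult_mat(1) index_minus_mat)
    ultimately show ?thesis
      using ik Ac[OF t] Bc[OF t] by (simp del: index_mult_mat(1))
  qed
  have dBe: "((\<lambda>t. B t $$ (k, j)) has_real_derivative c * (\<Sum>i<Ny.
      A t $$ (i, k) * (S $$ (i, j) - (\<Sum>l<Nh. A t $$ (i, l) * B t $$ (l, j))))) (at t within {0..})"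
    if kj: "k < Nh" "j < Nx" and t: "0 \<le> t" for k j t
  proof -
    have "((\<lambda>t. B t $$ (k, j)) has_real_derivative
        (c \<cdot>\<^sub>m ((A t)\<^sup>T * (S - A t * B t))) $$ (k, j)) (at t within {0..})"
      using dB[OF t] kj Ac[OF t] Bc[OF t] by (simp add: has_mat_derivative_def del: index_mult_mat(1))
    moreover have "((A t)\<^sup>T * (S - A t * B t)) $$ (k, j) = (\<Sum>i<Ny.
        A t $$ (i, k) * (S $$ (i, j) - (\<Sum>l<Nh. A t $$ (i, l) * B t $$ (l, j))))"
      using index_mult_mat_sum[OF _ SABc[OF t], of "(A t)\<^sup>T" Nh k j] kj t Ac[OF t]
      by (simp add: SAB del: index_mult_mat(1) index_minus_mat)
    ultimately show ?thesis
      using kj Ac[OF t] Bc[OF t] by (simp del: index_mult_mat(1))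
  qed
  have S_off: "S $$ (i, j) = 0" if "i < Ny" "j < Nx" "i \<noteq> j" for i j
    using S that by (auto simp: diagonal_mat_def)
  have A_off: "A t $$ (i, k) = 0" if "i < Ny" "k < Nh" "i \<noteq> k" "0 \<le> t" for i k t
    by (rule flow_stays_diagonal(1)[where S = "\<lambda>i j. S $$ (i, j)" and a = "\<lambda>i k t. A t $$ (i, k)"
          and b = "\<lambda>k j t. B t $$ (k, j)", OF dAe dBe])
      (use that M1 M2 S_off in \<open>auto simp: A0 B0 diagonal_mat_def\<close>)
  have B_off: "B t $$ (k, j) = 0" if "k < Nh" "j < Nx" "k \<noteq> j" "0 \<le> t" for k j t
    by (rule flow_stays_diagonal(2)[where S = "\<lambda>i j. S $$ (i, j)" and a = "\<lambda>i k t. A t $$ (i, k)"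
          and b = "\<lambda>k j t. B t $$ (k, j)", OF dAe dBe])
      (use that M1 M2 S_off in \<open>auto simp: A0 B0 diagonal_mat_def\<close>)
  \<comment> \<open>Only l = i = j survives in the sum over the hidden index, so modes beyond the
    hidden width have strength 0.\<close>
  have AB: "(A t * B t) $$ (i, j) = (if i = j \<and> i < Nh then A t $$ (i, i) * B t $$ (i, i) else 0)"
    if "i < Ny" "j < Nx" "0 \<le> t" for i j t
  proof -
    have "(\<Sum>l<Nh. A t $$ (i, l) * B t $$ (l, j))
        = (\<Sum>l<Nh. if l = i then (if i = j then A t $$ (i, i) * B t $$ (i, i) else 0) else 0)"
      using A_off B_off that by (intro sum.cong) auto
    then show ?thesis
      using index_mult_mat_sum[OF Ac Bc, OF that(3,3,1,2)] by (simp del: index_mult_mat)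
  qed
  have mode: "A T $$ (\<alpha>, \<alpha>) * B T $$ (\<alpha>, \<alpha>) = s * exp (2 * s * T / \<tau>) /
      (exp (2 * s * T / \<tau>) - 1 + s / (A 0 $$ (\<alpha>, \<alpha>) * B 0 $$ (\<alpha>, \<alpha>)))"
    if \<alpha>: "\<alpha> < Nh" and s: "s = S $$ (\<alpha>, \<alpha>)" "s \<noteq> 0"
      and m: "A 0 $$ (\<alpha>, \<alpha>) = B 0 $$ (\<alpha>, \<alpha>)" "A 0 $$ (\<alpha>, \<alpha>) \<noteq> 0" for \<alpha> s
  proof (rule single_mode_solution[where a = "\<lambda>t. A t $$ (\<alpha>, \<alpha>)"
        and b = "\<lambda>t. B t $$ (\<alpha>, \<alpha>)", OF _ _ m _ tau T])
    have lt: "\<alpha> < Ny" "\<alpha> < Nx" using \<alpha> dims by auto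
    \<comment> \<open>Singular values are nonnegative, so a nonzero one is positive.\<close>
    show "s > 0" using S0[of \<alpha>] s lt by auto
    fix t :: real assume t: "0 \<le> t"
    \<comment> \<open>Folding the inner sum back into a matrix product lets \<open>AB\<close>
      evaluate it.\<close>
    have res: "S $$ (i, j) - (\<Sum>l<Nh. A t $$ (i, l) * B t $$ (l, j)) = S $$ (i, j) - (A t * B t) $$ (i, j)"
      if "i < Ny" "j < Nx" for i j
      using index_mult_mat_sum[OF Ac Bc, OF t t that] by simp
    have "(\<Sum>j<Nx. (S $$ (\<alpha>, j) - (\<Sum>l<Nh. A t $$ (\<alpha>, l) * B t $$ (l, j))) * B t $$ (\<alpha>, j))
        = (\<Sum>j<Nx. if j = \<alpha> then (s - A t $$ (\<alpha>, \<alpha>) * B t $$ (\<alpha>, \<alpha>)) * B t $$ (\<alpha>, \<alpha>) else 0)"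
      using B_off \<alpha> lt t s by (intro sum.cong) (auto simp: res AB simp del: index_mult_mat)
    then show "((\<lambda>t. A t $$ (\<alpha>, \<alpha>)) has_real_derivative
        (s - A t $$ (\<alpha>, \<alpha>) * B t $$ (\<alpha>, \<alpha>)) * B t $$ (\<alpha>, \<alpha>) / \<tau>) (at t within {0..})"
      using dAe[OF lt(1) \<alpha> t] lt by (simp add: c_def)
    have "(\<Sum>i<Ny. A t $$ (i, \<alpha>) * (S $$ (i, \<alpha>) - (\<Sum>l<Nh. A t $$ (i, l) * B t $$ (l, \<alpha>))))
        = (\<Sum>i<Ny. if i = \<alpha> then A t $$ (\<alpha>, \<alpha>) * (s - A t $$ (\<alpha>, \<alpha>) * B t $$ (\<alpha>, \<alpha>)) else 0)"
      using A_off \<alpha> lt t s by (intro sum.cong) (auto simp: res AB simp del: index_mult_mat)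
    then show "((\<lambda>t. B t $$ (\<alpha>, \<alpha>)) has_real_derivative
        A t $$ (\<alpha>, \<alpha>) * (s - A t $$ (\<alpha>, \<alpha>) * B t $$ (\<alpha>, \<alpha>)) / \<tau>) (at t within {0..})"
      using dBe[OF \<alpha> lt(2) t] lt by (simp add: c_def)
  qed
  \<comment> \<open>The update in rotated coordinates: a difference of two diagonal products, hence
    diagonal.\<close>
  define F where "F = A T * B T - A 0 * B 0"
  note w = carrier_matD[OF W1c[OF T]] carrier_matD[OF W2c[OF T]]
    carrier_matD[OF W1c[of 0]] carrier_matD[OF W2c[of 0]]
  have Fc: "F \<in> carrier_mat Ny Nx"
    by (auto simp: F_def A0 B0 intro!: carrier_matI)
  have F: "F $$ (i, j) = (A T * B T) $$ (i, j) - (A 0 * B 0) $$ (i, j)" if "i < Ny" "j < Nx" for i j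
    using that Ac[of 0] Bc[of 0] by (simp add: F_def del: index_mult_mat(1))
  have "diagonal_mat F"
    unfolding diagonal_mat_def using Fc T by (auto simp: F AB simp del: index_mult_mat)
  moreover have "W2 T * W1 T - W2 0 * W1 0 = U * F * V\<^sup>T"
  proof -
    have D: "W2 T * W1 T - W2 0 * W1 0 \<in> carrier_mat Ny Nx"
      using w by (auto intro!: carrier_matI)
    have "F = U\<^sup>T * (W2 T * W1 T - W2 0 * W1 0) * V"
    proof -
      have AB_eq: "A t * B t = U\<^sup>T * (W2 t * W1 t) * V" if "0 \<le> t" for t
        using W1c[OF that] W2c[OF that] by (simp add: A_def B_def assoc_mult_mat_dim cancel)
      have "U\<^sup>T * (W2 T * W1 T - W2 0 * W1 0) = U\<^sup>T * (W2 T * W1 T) - U\<^sup>T * (W2 0 * W1 0)"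
        by (rule mult_minus_distrib_mat) (use w in \<open>auto intro!: carrier_matI\<close>)
      moreover have "(U\<^sup>T * (W2 T * W1 T) - U\<^sup>T * (W2 0 * W1 0)) * V
          = U\<^sup>T * (W2 T * W1 T) * V - U\<^sup>T * (W2 0 * W1 0) * V"
        by (rule minus_mult_distrib_mat) (use w in \<open>auto intro!: carrier_matI\<close>)
      ultimately show ?thesis by (simp add: F_def AB_eq T)
    qed
    moreover have "V * V\<^sup>T = 1\<^sub>m Nx" using V by (simp add: real_orthogonal_mat_def)
    ultimately show ?thesis using D carrier_matD[OF D]
      by (simp add: assoc_mult_mat_dim cancel del: index_minus_mat)
  qed
  ultimately have dec: "mode_decomposition Ny Nx (W2 T * W1 T - W2 0 * W1 0) U F V"
    using U V Fc by (simp add: mode_decomposition_def)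
  show "\<exists>F. mode_decomposition Ny Nx (W2 T * W1 T - W2 0 * W1 0) U F V \<and>
     (\<forall>\<alpha><Nh. let s = S $$ (\<alpha>, \<alpha>); u0 = (M2 * M1) $$ (\<alpha>, \<alpha>); uf = F $$ (\<alpha>, \<alpha>) in
        M2 $$ (\<alpha>, \<alpha>) = M1 $$ (\<alpha>, \<alpha>) \<and> u0 \<noteq> 0 \<and> s \<noteq> 0 \<longrightarrow>
        uf = s * exp (2 * s * T / \<tau>) / (exp (2 * s * T / \<tau>) - 1 + s / u0) - u0)"
  proof (intro exI[of _ F] conjI allI impI dec, unfold Let_def, intro impI, elim conjE)
    fix \<alpha> assume \<alpha>: "\<alpha> < Nh" and m: "M2 $$ (\<alpha>, \<alpha>) = M1 $$ (\<alpha>, \<alpha>)"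
      "(M2 * M1) $$ (\<alpha>, \<alpha>) \<noteq> 0" "S $$ (\<alpha>, \<alpha>) \<noteq> 0"
    have lt: "\<alpha> < Ny" "\<alpha> < Nx" using \<alpha> dims by auto
    \<comment> \<open>As a product of the two initial diagonal entries, a nonzero \<open>u0\<close>
      forces the nonzero start that \<open>mode\<close> requires.\<close>
    have u0: "(M2 * M1) $$ (\<alpha>, \<alpha>) = A 0 $$ (\<alpha>, \<alpha>) * B 0 $$ (\<alpha>, \<alpha>)"
      using AB[OF lt, of 0] \<alpha> by (simp add: A0 B0 del: index_mult_mat)
    show "F $$ (\<alpha>, \<alpha>) = S $$ (\<alpha>, \<alpha>) * exp (2 * S $$ (\<alpha>, \<alpha>) * T / \<tau>) /
        (exp (2 * S $$ (\<alpha>, \<alpha>) * T / \<tau>) - 1 + S $$ (\<alpha>, \<alpha>) / (M2 * M1) $$ (\<alpha>, \<alpha>))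
        - (M2 * M1) $$ (\<alpha>, \<alpha>)"
      using mode[OF \<alpha> refl] m u0 \<alpha> T by (simp add: F[OF lt] AB[OF lt] A0 B0 del: index_mult_mat)
  qed
qed

end
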